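(* Let $A \in \mathbb{F}_2[x]$ be a nonconstant polynomial such that $\omega(A) \leq 3$. Then $A$ is unitary perfect over $\mathbb{F}_2$ if and only if at least one of $A(x)$, $A(x+1)$ is of the form $B^{2^n}$ for some nonnegative integer $n$, where $B$ is one of the following polynomials: (i) $B = x^2+x$; (ii) $B \in \{x^3(x+1)^2(x^2+x+1),\ x^5(x+1)^4(x^4+x^3+x^2+x+1)\}$; (iii) $B = x^3(x+1)^3(x^2+x+1)^2$.
   Context: For a nonzero polynomial $A \in \mathbb{F}_2[x]$, $\omega(A)$ denotes the number of distinct monic irreducible factors of $A$ over $\mathbb{F}_2$. A divisor $d$ of $A$ is called unitary if $d$ is monic and $\gcd(d, A/d) = 1$. $\sigma^*(A)$ denotes the sum of all unitary divisors of $A$. The polynomial $A$ is called unitary perfect if $\sigma^*(A) = A$. *)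

theory Defs
  imports "HOL-Library.Z2" "HOL-Computational_Algebra.Polynomial"
begin

text \<open>
  The field with two elements is the library type \<^typ>\<open>bit\<close>.  The functions below are meant
  for nonzero polynomials; at zero, \<open>omega\<close> is \<^term>\<open>card\<close> of an infinite set, that is, 0.
\<close>

abbreviation X :: "bit poly" where
  "X \<equiv> [:0, 1:]"

definition omega :: "bit poly \<Rightarrow> nat" where
  "omega A = card {p. irreducible p \<and> lead_coeff p = 1 \<and> p dvd A}"

definition unitary_divisors :: "bit poly \<Rightarrow> bit poly set" where
  "unitary_divisors A = {d. d dvd A \<and> lead_coeff d = 1 \<and> coprime d (A div d)}"

definition sigma_star :: "bit poly \<Rightarrow> bit poly" where
  "sigma_star A = (\<Sum>d\<in>unitary_divisors A. d)"

definition unitary_perfect :: "bit poly \<Rightarrow> bool" where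
  "unitary_perfect A \<longleftrightarrow> sigma_star A = A"

end

theory Submission
  imports Defs "HOL-Computational_Algebra.Polynomial_Factorial"
begin

text \<open>
  Since \<open>sigma_star\<close> is multiplicative, \<open>A\<close> is unitary perfect iff the product of all \<open>1 + p ^ a\<close>,
  where \<open>p ^ a\<close> runs over the exact prime powers in \<open>A\<close>, is \<open>A\<close>.  Looking at the values at \<open>0\<close> and
  \<open>1\<close>, both \<open>X\<close> and \<open>X + 1\<close> divide \<open>A\<close>, so \<open>A = X ^ a * (X + 1) ^ b * p ^ c\<close>.  Write
  \<open>a = m * 2 ^ k\<close> with \<open>m\<close> odd.  Then \<open>1 + X ^ a\<close> is the \<open>2 ^ k\<close>-th power of the squarefree
  polynomial \<open>1 + X ^ m\<close>, whence \<open>1 + X + ... + X ^ (m - 1)\<close> is \<open>1\<close> or \<open>p\<close>, and likewise for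
  \<open>b\<close> with \<open>X + 1\<close> in place of \<open>X\<close>.  Moreover \<open>c\<close> is a power of \<open>2\<close> and \<open>1 + p\<close> is a product of
  powers of \<open>X\<close> and \<open>X + 1\<close>, which forces \<open>m = 2 ^ q + 1\<close> if \<open>m > 1\<close>; irreducibility of \<open>p\<close> leaves only
  \<open>q = 1\<close> and \<open>q = 2\<close>.  Comparing exponents on both sides finishes the proof.
\<close>

section \<open>Prime powers and divisibility\<close>

text \<open>By primality, one \<open>p\<close> in \<open>p ^ Suc n * b = d * k\<close> sits in
  \<open>d\<close> or in \<open>k\<close> and can be cancelled there.\<close>

lemma dvd_prime_power_mult:
  fixes p :: "'a :: idom"
  assumes "prime_elem p" "d dvd p ^ n * b"
  shows "\<exists>i e. d = p ^ i * e \<and> e dvd b"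
  using assms(2)
proof (induction n arbitrary: d)
  case 0
  then show ?case by (intro exI[of _ 0] exI[of _ d]) auto
next
  case (Suc n)
  then obtain k where k: "p * (p ^ n * b) = d * k"
    by (auto simp: dvd_def mult.assoc)
  then have "p dvd d * k"
    by (metis dvd_triv_left)
  then consider d' where "d = p * d'" | k' where "k = p * k'"
    using assms(1) by (force simp: prime_elem_dvd_mult_iff)
  then show ?case
  proof cases
    case 1
    then have "d' dvd p ^ n * b"
      using k assms(1) by (auto simp: dvd_def mult.assoc)
    then obtain i e where "d' = p ^ i * e" "e dvd b"
      using Suc.IH by blast
    then show ?thesis
      using 1 by (intro exI[of _ "Suc i"] exI[of _ e]) (simp add: mult.assoc)
  next
    case 2
    then have "p * (p ^ n * b) = p * (d * k')"
      using k by (simp add: mult_ac)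
    then have "d dvd p ^ n * b"
      using assms(1) by auto
    then show ?thesis
      using Suc.IH by blast
  qed
qed

lemma dvd_prime_power_mult_cancel:
  fixes p :: "'a :: idom"
  assumes "prime_elem p" "\<not> p dvd d" "d dvd p ^ n * b"
  shows "d dvd b"
proof -
  obtain i e where "d = p ^ i * e" "e dvd b"
    using dvd_prime_power_mult assms by blast
  then show ?thesis
    using assms(2) by (cases i) auto
qed

lemma prime_power_mult_eqD:
  fixes p :: "'a :: idom"
  assumes "prime_elem p" "\<not> p dvd u" "\<not> p dvd v" "p ^ i * u = p ^ j * v"
  shows "i = j \<and> u = v"
proof -
  have "i = j"
    using assms
  proof (induction i arbitrary: j)
    case 0
    then show ?case by (cases j) auto
  next
    case (Suc i)
    then show ?case by (cases j) (auto simp: mult.assoc)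
  qed
  then show ?thesis
    using assms by auto
qed

section \<open>Polynomials over the field with two elements\<close>

lemma bit_poly_minus [simp]: "- p = (p :: bit poly)"
  by (rule poly_eqI) simp

lemma bit_poly_diff: "p - q = p + (q :: bit poly)"
  by (metis bit_poly_minus diff_conv_add_uminus)

lemma bit_poly_double [simp]: "p + p = (0 :: bit poly)"
  by (metis bit_poly_minus ab_left_minus)

lemma bit_poly_add_eq_0_iff: "p + q = 0 \<longleftrightarrow> p = (q :: bit poly)"
  by (metis bit_poly_diff right_minus_eq)

lemma bit_poly_add_cancel [simp]: "p + (p + q) = (q :: bit poly)"
  by (simp flip: add.assoc)

lemma bit_poly_unit_iff: "(u :: bit poly) dvd 1 \<longleftrightarrow> u = 1"
  by (metis bit_not_zero_iff dvd_refl is_unit_polyE')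

lemma bit_poly_degree_0: "degree (p :: bit poly) = 0 \<Longrightarrow> p \<noteq> 0 \<Longrightarrow> p = 1"
  by (simp add: is_unit_iff_degree flip: bit_poly_unit_iff)

text \<open>Squaring is additive in characteristic 2, as the two cross terms cancel.\<close>

lemma bit_poly_power_pow2_add: "(p + q) ^ 2 ^ k = p ^ 2 ^ k + (q :: bit poly) ^ 2 ^ k"
proof (induction k)
  case (Suc k)
  have "(p + q) ^ 2 ^ Suc k = ((p + q) ^ 2 ^ k) ^ 2"
    by (simp flip: power_mult add: mult.commute)
  also have "\<dots> = (p ^ 2 ^ k) ^ 2 + (q ^ 2 ^ k) ^ 2"
    by (simp add: Suc power2_eq_square algebra_simps)
  finally show ?case
    by (simp flip: power_mult add: mult.commute)
qed simp

lemma bit_poly_irreducible_imp_prime: "irreducible p \<Longrightarrow> prime_elem (p :: bit poly)"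
  by (rule field_poly_irreducible_imp_prime)

lemma bit_poly_irreducible_dvd_irreducible:
  assumes "irreducible p" "irreducible q" "p dvd (q :: bit poly)"
  shows "p = q"
proof -
  obtain k where k: "q = p * k" using assms(3) by auto
  then have "p dvd 1 \<or> k dvd 1"
    using assms(2) by (rule irreducibleD[rotated])
  then show ?thesis
    using assms(1) k by (auto simp: bit_poly_unit_iff)
qed

lemma finite_divisors_bit_poly:
  assumes "(A :: bit poly) \<noteq> 0"
  shows "finite {d. d dvd A}"
proof (rule finite_imageD)
  have "coeffs ` {d. d dvd A} \<subseteq> {xs. set xs \<subseteq> {0, 1} \<and> length xs \<le> Suc (degree A)}"
    using dvd_imp_degree_le[OF _ assms] by (auto simp: length_coeffs le_SucI split: if_splits simp: coeffs_def)
  then show "finite (coeffs ` {d. d dvd A})"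
    by (rule finite_subset) (rule finite_lists_length_le, simp)
  show "inj_on coeffs {d. d dvd A}"
    by (auto intro!: inj_onI simp: coeffs_eq_iff)
qed

lemma bit_poly_irreducible_divisor:
  assumes "degree A > 0"
  shows "\<exists>p. irreducible p \<and> p dvd (A :: bit poly)"
  using assms
proof (induction "degree A" arbitrary: A rule: less_induct)
  case less
  show ?case
  proof (cases "irreducible A")
    case False
    then obtain b c where bc: "A = b * c" "b \<noteq> 1" "c \<noteq> 1"
      using less.prems by (auto simp: irreducible_def bit_poly_unit_iff is_unit_iff_degree)
    have nz: "b \<noteq> 0" "c \<noteq> 0"
      using bc less.prems by auto
    then have "degree b > 0" "degree c > 0"
      using bc bit_poly_degree_0 by blast+
    moreover have "degree A = degree b + degree c"
      using bc nz by (simp add: degree_mult_eq)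
    ultimately obtain p where "irreducible p" "p dvd b"
      using less.hyps[of b] by auto
    then show ?thesis
      using bc by auto
  qed auto
qed

lemma bit_poly_prime_power_split:
  assumes "(A :: bit poly) \<noteq> 0" "irreducible p"
  shows "\<exists>n B. A = p ^ n * B \<and> \<not> p dvd B"
  using assms(1)
proof (induction "degree A" arbitrary: A rule: less_induct)
  case less
  have p: "degree p > 0"
  proof (rule ccontr)
    assume "\<not> degree p > 0"
    then have "p = 0 \<or> p = 1" using bit_poly_degree_0[of p] by blast
    then show False using assms(2) by auto
  qed
  show ?case
  proof (cases "p dvd A")
    case True
    then obtain C where C: "A = p * C" by auto
    then have "degree A = degree p + degree C" "C \<noteq> 0"
      using less.prems by (auto simp: degree_mult_eq)
    then obtain n B where "C = p ^ n * B" "\<not> p dvd B"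
      using less.hyps[of C] p by auto
    then show ?thesis
      using C by (intro exI[of _ "Suc n"] exI[of _ B]) (simp add: mult.assoc)
  next
    case False
    then show ?thesis by (intro exI[of _ 0] exI[of _ A]) auto
  qed
qed

section \<open>Multiplicativity of the unitary divisor sum\<close>

text \<open>Every nonzero polynomial over this field is monic, so only a coprime factorization
  remains, symmetric in divisor and cofactor.\<close>

lemma unitary_divisors_alt:
  assumes "A \<noteq> 0"
  shows "d \<in> unitary_divisors A \<longleftrightarrow> (\<exists>e. A = d * e \<and> coprime d e)"
proof
  assume "\<exists>e. A = d * e \<and> coprime d e"
  then obtain e where e: "A = d * e" "coprime d e" by blast
  then show "d \<in> unitary_divisors A"
    using assms by (auto simp: unitary_divisors_def leading_coeff_neq_0 simp flip: bit_not_zero_iff)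
qed (auto simp: unitary_divisors_def intro: exI[of _ "A div d"])

lemma finite_unitary_divisors: "A \<noteq> 0 \<Longrightarrow> finite (unitary_divisors A)"
  by (rule finite_subset[OF _ finite_divisors_bit_poly]) (auto simp: unitary_divisors_def)

lemma unitary_divisors_1: "unitary_divisors 1 = {1}"
  by (auto simp: unitary_divisors_def bit_poly_unit_iff)

lemma sigma_star_1 [simp]: "sigma_star 1 = 1"
  by (simp add: sigma_star_def unitary_divisors_1)

lemma coprime_mult_prime_power:
  fixes p :: "'a :: {idom, algebraic_semidom}"
  assumes "prime_elem p" "\<not> p dvd d" "coprime d e"
  shows "coprime d (p ^ n * e)"
proof (rule coprimeI)
  fix c assume c: "c dvd d" "c dvd p ^ n * e"
  then have "c dvd e"
    using assms dvd_prime_power_mult_cancel dvd_trans by metis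
  then show "is_unit c"
    using c assms(3) coprime_common_divisor by blast
qed

text \<open>A unitary divisor contains either no factor \<open>p\<close> or all of
  \<open>p ^ n\<close>; removing the latter matches both kinds with the unitary divisors of
  \<open>B\<close>.\<close>

lemma sigma_star_prime_power_mult:
  assumes p: "prime_elem p" and "\<not> p dvd B" "n > 0"
  shows "sigma_star (p ^ n * B) = (1 + p ^ n) * sigma_star B"
proof -
  have B: "B \<noteq> 0" using assms by auto
  then have A: "p ^ n * B \<noteq> 0" using p by auto
  have coprD: "\<not> p dvd e" if "coprime d e" "p dvd d" for d e
    using that p coprime_common_divisor by fastforce
  have "unitary_divisors (p ^ n * B) = unitary_divisors B \<union> (*) (p ^ n) ` unitary_divisors B"
    (is "?L = ?R")
  proof (intro equalityI subsetI)
    fix d assume "d \<in> ?L"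
    then obtain e where e: "p ^ n * B = d * e" "coprime d e"
      using A unitary_divisors_alt by blast
    show "d \<in> ?R"
    proof (cases "p dvd d")
      case False
      then have "d dvd B"
        using dvd_prime_power_mult_cancel[OF p False] e by (metis dvd_triv_left)
      then obtain k where k: "B = d * k" by auto
      then have "e = p ^ n * k"
        using e B by (metis mult.left_commute mult_cancel_left mult_eq_0_iff)
      then have "coprime d k" using e(2) by (metis coprime_divisors dvd_refl dvd_triv_right)
      then show ?thesis using k B unitary_divisors_alt by blast
    next
      case True
      then have "\<not> p dvd e" using coprD e by blast
      then have "e dvd B"
        using dvd_prime_power_mult_cancel[OF p] e by (metis dvd_triv_right)
      then obtain k where k: "B = k * e" by (metis dvd_def mult.commute)
      then have "d = p ^ n * k"
        using e B by (metis mult.assoc mult_cancel_right mult_eq_0_iff)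
      moreover from this have "coprime k e" using e(2) by (metis coprime_divisors dvd_refl dvd_triv_right)
      ultimately show ?thesis using k B unitary_divisors_alt by blast
    qed
  next
    fix d assume "d \<in> ?R"
    then obtain k e where k: "B = k * e" "coprime k e" "d = k \<or> d = p ^ n * k"
      using B unitary_divisors_alt by blast
    have nd: "\<not> p dvd k" "\<not> p dvd e" using k(1) assms(2) by auto
    from k(3) have "\<exists>e'. p ^ n * B = d * e' \<and> coprime d e'"
    proof
      assume "d = k"
      then show ?thesis
        using k(1,2) nd coprime_mult_prime_power[OF p, of k e n]
        by (intro exI[of _ "p ^ n * e"]) (simp add: mult_ac)
    next
      assume "d = p ^ n * k"
      then show ?thesis
        using k(1,2) nd coprime_mult_prime_power[OF p, of e k n]
        by (intro exI[of _ e]) (simp add: mult_ac coprime_commute)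
    qed
    then show "d \<in> ?L" using A unitary_divisors_alt by blast
  qed
  moreover have "unitary_divisors B \<inter> (*) (p ^ n) ` unitary_divisors B = {}"
  proof -
    have "\<not> p dvd d" if "d \<in> unitary_divisors B" for d
      using that assms(2) by (auto simp: unitary_divisors_def)
    then show ?thesis
      using assms(3) by fastforce
  qed
  ultimately have "sigma_star (p ^ n * B) = sigma_star B + (\<Sum>d\<in>(*) (p ^ n) ` unitary_divisors B. d)"
    unfolding sigma_star_def using finite_unitary_divisors[OF B] by (simp add: sum.union_disjoint)
  also have "(\<Sum>d\<in>(*) (p ^ n) ` unitary_divisors B. d) = p ^ n * sigma_star B"
    unfolding sigma_star_def using p
    by (subst sum.reindex) (auto intro!: inj_onI simp: sum_distrib_left)
  finally show ?thesis by (simp add: algebra_simps)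
qed

section \<open>The substitution of X + 1 for X\<close>

text \<open>This involutive automorphism exchanges \<open>X\<close> and \<open>X + 1\<close>, so
  results about \<open>1 + X ^ a\<close> carry over to \<open>1 + (X + 1) ^ b\<close>.\<close>

definition shift :: "bit poly \<Rightarrow> bit poly" where
  "shift p = pcompose p (X + 1)"

lemma shift_add: "shift (p + q) = shift p + shift q"
  by (simp add: shift_def pcompose_add)

lemma shift_mult: "shift (p * q) = shift p * shift q"
  by (simp add: shift_def pcompose_mult)

lemma shift_1 [simp]: "shift 1 = 1"
  by (simp add: shift_def pcompose_1)

lemma shift_0 [simp]: "shift 0 = 0"
  by (simp add: shift_def)

lemma shift_power: "shift (p ^ n) = shift p ^ n"
  by (induction n) (simp_all add: shift_mult)

lemma shift_sum: "shift (sum f A) = (\<Sum>x\<in>A. shift (f x))"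
  by (simp add: shift_def pcompose_sum)

lemma shift_X: "shift X = X + 1"
  by (simp add: shift_def pcompose_pCons)

lemma shift_X1: "shift (X + 1) = X"
  by (simp only: shift_add shift_X shift_1 add.assoc bit_poly_double add_0_right)

lemma shift_shift [simp]: "shift (shift p) = p"
proof -
  have "shift (shift p) = pcompose p (shift (X + 1))"
    by (simp only: shift_def pcompose_assoc)
  then show ?thesis by (simp only: shift_X1 pcompose_idR)
qed

lemma shift_eq_iff: "shift p = shift q \<longleftrightarrow> p = q"
  by (metis shift_shift)

lemma shift_dvd_iff: "shift p dvd shift q \<longleftrightarrow> p dvd q"
  by (metis dvd_def shift_mult shift_shift)

lemma irreducible_shift: "irreducible p \<Longrightarrow> irreducible (shift p)"
  unfolding irreducible_def bit_poly_unit_iff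
  by (metis shift_0 shift_1 shift_mult shift_shift)

lemma coprime_shift: "coprime d e \<Longrightarrow> coprime (shift d) (shift e)"
  unfolding coprime_def by (metis shift_1 shift_dvd_iff shift_shift)

lemma shift_unitary_divisors:
  assumes "A \<noteq> 0"
  shows "unitary_divisors (shift A) = shift ` unitary_divisors A"
proof -
  have shift_A: "shift A \<noteq> 0" using assms by (metis shift_0 shift_shift)
  have *: "shift d \<in> unitary_divisors (shift B)" if "d \<in> unitary_divisors B" "B \<noteq> 0" "shift B \<noteq> 0" for d B
    using that coprime_shift by (auto simp: unitary_divisors_alt shift_mult)
  show ?thesis
  proof (intro equalityI subsetI)
    fix d assume "d \<in> unitary_divisors (shift A)"
    then have "shift d \<in> unitary_divisors A"
      using *[of d "shift A"] assms shift_A by simp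
    then show "d \<in> shift ` unitary_divisors A"
      by (metis imageI shift_shift)
  qed (use * assms shift_A in auto)
qed

lemma unitary_perfect_shift_iff:
  assumes "A \<noteq> 0"
  shows "unitary_perfect (shift A) \<longleftrightarrow> unitary_perfect A"
proof -
  have "sigma_star (shift A) = shift (sigma_star A)"
    unfolding sigma_star_def shift_unitary_divisors[OF assms] shift_sum
    by (subst sum.reindex) (auto intro!: inj_onI simp: shift_eq_iff)
  then show ?thesis
    by (simp add: unitary_perfect_def shift_eq_iff)
qed

section \<open>Factors of 1 + f ^ n\<close>

lemma X_dvd_iff: "X dvd p \<longleftrightarrow> poly p 0 = 0"
  using poly_eq_0_iff_dvd[of p 0] by simp

lemma X1_dvd_iff: "X + 1 dvd p \<longleftrightarrow> poly p 1 = 0"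
  using poly_eq_0_iff_dvd[of p 1] by (simp add: one_pCons)

lemma prime_X: "prime_elem X"
  by (rule prime_elem_linear_field_poly) simp

lemma prime_X1: "prime_elem (X + 1)"
  using prime_elem_linear_field_poly[of 1 1] by (simp add: one_pCons)

text \<open>A root at 0 or 1 would make \<open>X\<close> or \<open>X + 1\<close> a divisor, hence
  equal to \<open>p\<close>.\<close>

lemma irreducible_poly_eq_1:
  assumes "irreducible p"
  shows "p \<noteq> X \<Longrightarrow> poly p 0 = 1" and "p \<noteq> X + 1 \<Longrightarrow> poly p 1 = 1"
  using bit_poly_irreducible_dvd_irreducible[OF _ assms] prime_X prime_X1 prime_elem_imp_irreducible
    X_dvd_iff X1_dvd_iff bit_not_zero_iff by blast+

lemma dvd_X_X1_power_mult_cancel: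
  assumes "poly d 0 = 1" "poly d 1 = 1" "d dvd X ^ i * ((X + 1) ^ j * B)"
  shows "d dvd B"
proof -
  have nd: "\<not> X dvd d" "\<not> X + 1 dvd d"
    unfolding X_dvd_iff X1_dvd_iff assms by simp_all
  show ?thesis
    using dvd_prime_power_mult_cancel[OF prime_X nd(1) assms(3)]
    by (rule dvd_prime_power_mult_cancel[OF prime_X1 nd(2)])
qed

text \<open>The cofactor of \<open>1 + f\<close> in \<open>1 + f ^ n\<close>, needed for
  \<open>f = X\<close> and for a further prime \<open>f = p\<close>.\<close>

definition geo :: "nat \<Rightarrow> bit poly \<Rightarrow> bit poly" where
  "geo n f = (\<Sum>i<n. f ^ i)"

lemma one_plus_power: "1 + f ^ n = (1 + f) * geo n f"
  using one_diff_power_eq[of f n] by (simp add: geo_def bit_poly_diff)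

lemma of_nat_bit_odd: "odd n \<Longrightarrow> (of_nat n :: bit) = 1"
  by (metis bit_not_zero_iff even_of_nat dvd_0_right)

lemma poly_geo_odd: "odd n \<Longrightarrow> poly f c = 1 \<Longrightarrow> poly (geo n f) c = 1"
  by (simp add: geo_def poly_sum of_nat_bit_odd)

lemma poly_geo_X_0: "n > 0 \<Longrightarrow> poly (geo n X) 0 = 1"
  by (simp add: geo_def poly_sum power_0_left)

lemma coeff_geo_X: "coeff (geo n X) i = (if i < n then 1 else 0)"
proof -
  have "geo n X = (\<Sum>i<n. monom 1 i)"
    by (simp add: geo_def monom_altdef)
  then show ?thesis by (simp add: coeff_sum)
qed

lemma degree_geo_X: "degree (geo n X) = n - 1"
proof (cases n)
  case (Suc m)
  then have "degree (geo n X) \<le> m" "coeff (geo n X) m \<noteq> 0"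
    by (auto simp: coeff_geo_X intro!: degree_le)
  then show ?thesis using Suc le_degree[of "geo n X" m] by simp
qed (simp add: geo_def)

lemma geo_X_eq_1_iff: "n > 0 \<Longrightarrow> geo n X = 1 \<longleftrightarrow> n = 1"
  using degree_geo_X[of n] by (auto simp: geo_def)

lemma pow2_odd_decomp:
  assumes "(n::nat) > 0"
  shows "\<exists>k m. odd m \<and> n = m * 2 ^ k"
  using assms
proof (induction n rule: less_induct)
  case (less n)
  show ?case
  proof (cases "odd n")
    case True
    then show ?thesis by (intro exI[of _ 0] exI[of _ n]) simp
  next
    case False
    then obtain r where r: "n = 2 * r" by auto
    then obtain k m where "odd m" "r = m * 2 ^ k"
      using less.IH[of r] less.prems by auto
    then show ?thesis using r by (intro exI[of _ "Suc k"] exI[of _ m]) simp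
  qed
qed

lemma one_plus_power_pow2: "1 + f ^ (m * 2 ^ k) = (1 + f ^ m :: bit poly) ^ 2 ^ k"
  by (simp add: bit_poly_power_pow2_add power_mult)

text \<open>The derivative of \<open>1 + X ^ m\<close> is \<open>X ^ (m - 1)\<close>, so \<open>1 + X ^ m\<close> is squarefree.\<close>

lemma not_square_dvd_one_plus_X_power:
  assumes "odd m" "irreducible p"
  shows "\<not> p ^ 2 dvd 1 + X ^ m"
proof
  assume "p ^ 2 dvd 1 + X ^ m"
  then obtain g where g: "1 + X ^ m = p ^ 2 * g" by auto
  have p: "prime_elem p" using assms(2) by (rule bit_poly_irreducible_imp_prime)
  have "pderiv (1 + X ^ m) = X ^ (m - 1)"
    using assms(1) by (simp add: pderiv_add pderiv_power pderiv_pCons of_nat_bit_odd)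
  moreover have "p dvd pderiv (p ^ 2 * g)"
    by (auto simp: pderiv_mult power2_eq_square intro!: dvd_add)
  ultimately have "p dvd X ^ (m - 1)" using g by simp
  then have "p dvd X" using p prime_elem_dvd_power by blast
  then have "p = X"
    using assms(2) prime_X bit_poly_irreducible_dvd_irreducible prime_elem_imp_irreducible by blast
  then have "X dvd 1 + X ^ m" using g by (metis dvd_mult2 dvd_triv_left power2_eq_square)
  then have "poly (1 + X ^ m) 0 = 0" by (simp only: X_dvd_iff)
  then show False using assms(1) by (auto simp: power_0_left)
qed

text \<open>Dividing a power of \<open>p\<close>, the sum is some \<open>p ^ i\<close>; it also
  divides the squarefree \<open>1 + X ^ m\<close>, so \<open>i\<close> is 0 or 1.\<close>

lemma geo_X_eq_prime:
  assumes "odd m" "irreducible p" "geo m X dvd p ^ k"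
  shows "m = 1 \<or> geo m X = p"
proof -
  have p: "prime_elem p" using assms(2) by (rule bit_poly_irreducible_imp_prime)
  obtain i where i: "geo m X = p ^ i"
    using dvd_prime_power_mult[OF p, of "geo m X" k 1] assms(3) by (auto simp: bit_poly_unit_iff)
  have "\<not> i \<ge> 2"
  proof
    assume "i \<ge> 2"
    then have "p ^ 2 dvd 1 + X ^ m" unfolding one_plus_power i by (intro dvd_mult le_imp_power_dvd)
    then show False using not_square_dvd_one_plus_X_power assms by blast
  qed
  then consider "i = 0" | "i = 1" by linarith
  then show ?thesis
  proof cases
    case 1
    then show ?thesis using i geo_X_eq_1_iff[of m] assms(1) by (auto simp: odd_pos)
  qed (use i in simp)
qed

text \<open>For the odd part \<open>m\<close> of \<open>a\<close>, \<open>geo m X\<close> divides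
  \<open>1 + X ^ a\<close> and has value 1 at both 0 and 1, so it must divide
  \<open>p ^ k\<close>.\<close>

lemma one_plus_X_power_dvd:
  assumes "a > 0" "irreducible p" "1 + X ^ a dvd X ^ i * ((X + 1) ^ j * p ^ k)"
  shows "\<exists>m l. odd m \<and> a = m * 2 ^ l \<and> (m = 1 \<or> geo m X = p)"
proof -
  obtain m l where ml: "odd m" "a = m * 2 ^ l" using pow2_odd_decomp assms(1) by blast
  have "geo m X dvd 1 + X ^ m" by (simp only: one_plus_power dvd_triv_right)
  also have "\<dots> dvd 1 + X ^ a"
    unfolding ml(2) one_plus_power_pow2 by (rule dvd_power) simp
  finally have "geo m X dvd X ^ i * ((X + 1) ^ j * p ^ k)" using assms(3) dvd_trans by blast
  then have "geo m X dvd p ^ k"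
    by (rule dvd_X_X1_power_mult_cancel[rotated 2])
      (use ml(1) in \<open>simp_all add: poly_geo_X_0 poly_geo_odd odd_pos\<close>)
  then show ?thesis using geo_X_eq_prime assms(2) ml by blast
qed

text \<open>For the odd part \<open>r\<close> of \<open>c\<close>, \<open>1 + p ^ r\<close> is prime
  to \<open>p\<close>, so it is built from \<open>X\<close> and \<open>X + 1\<close> alone. Its
  factor \<open>geo r p\<close> has value 1 at 0 and 1, hence is a unit, and
  \<open>p ^ r = p\<close>.\<close>

lemma one_plus_prime_power_dvd:
  assumes "c > 0" "irreducible p" "p \<noteq> X" "p \<noteq> X + 1" "1 + p ^ c dvd X ^ i * ((X + 1) ^ j * p ^ k)"
  shows "\<exists>l. c = 2 ^ l" and "\<exists>e f. 1 + p = X ^ e * (X + 1) ^ f"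
proof -
  have p: "prime_elem p" using assms(2) by (rule bit_poly_irreducible_imp_prime)
  have val: "poly p 0 = 1" "poly p 1 = 1" using irreducible_poly_eq_1 assms by auto
  obtain r l where rl: "odd r" "c = r * 2 ^ l" using pow2_odd_decomp assms(1) by blast
  have d1: "1 + p ^ r dvd 1 + p ^ c"
    unfolding rl(2) one_plus_power_pow2 by (rule dvd_power) simp
  have np: "\<not> p dvd 1 + p ^ r"
  proof
    assume *: "p dvd 1 + p ^ r"
    have "p dvd p ^ r" using odd_pos[OF rl(1)] by simp
    then have "p dvd 1" using * dvd_add_left_iff by blast
    then show False using p by auto
  qed
  have "1 + p ^ r dvd p ^ k * (X ^ i * (X + 1) ^ j)"
    using dvd_trans[OF d1 assms(5)] by (simp only: mult_ac)
  then have dvd: "1 + p ^ r dvd X ^ i * (X + 1) ^ j"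
    using dvd_prime_power_mult_cancel[OF p np] by blast
  then have "geo r p dvd X ^ i * ((X + 1) ^ j * 1)"
    unfolding one_plus_power mult_1_right by (rule dvd_mult_right)
  then have "geo r p dvd 1"
    by (rule dvd_X_X1_power_mult_cancel[rotated 2]) (use rl(1) val in \<open>simp_all add: poly_geo_odd\<close>)
  then have "geo r p = 1" by (simp only: bit_poly_unit_iff)
  then have eq: "1 + p ^ r = 1 + p" using one_plus_power[of p r] by simp
  then have "p ^ r = p ^ 1" by simp
  have "r = 1"
  proof (rule ccontr)
    assume "r \<noteq> 1"
    then obtain t where "r = Suc (Suc t)" using rl(1) by (cases r; cases "r - 1") auto
    then have "p * 1 = p * (p * p ^ t)" using \<open>p ^ r = p ^ 1\<close> by simp
    then have "1 = p * p ^ t" using p by (subst (asm) mult_cancel_left) auto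
    then have "p dvd 1" by (rule dvdI)
    then show False using p by auto
  qed
  then show "\<exists>l. c = 2 ^ l" using rl by auto
  obtain e v where ev: "1 + p = X ^ e * v" "v dvd (X + 1) ^ j"
    using dvd_prime_power_mult[OF prime_X, of "1 + p ^ r" i "(X + 1) ^ j"] dvd unfolding eq by blast
  then obtain f w where "v = (X + 1) ^ f * w" "w dvd 1"
    using dvd_prime_power_mult[OF prime_X1, of v j 1] unfolding mult_1_right by blast
  then have "v = (X + 1) ^ f" by (simp only: bit_poly_unit_iff mult_1_right)
  then show "\<exists>e f. 1 + p = X ^ e * (X + 1) ^ f" using ev by blast
qed

text \<open>Here \<open>1 + X ^ n\<close> is a power of \<open>X + 1\<close>. For the odd part
  \<open>m\<close> of \<open>n\<close>, \<open>geo m X\<close> divides it without vanishing at 0 or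
  1, so \<open>m = 1\<close>; comparing degrees gives \<open>f\<close>.\<close>

lemma geo_X_eq_X1_power:
  assumes "n > 0" "geo n X = (X + 1) ^ f"
  shows "\<exists>q. n = 2 ^ q" and "f = n - 1"
proof -
  obtain m l where ml: "odd m" "n = m * 2 ^ l" using pow2_odd_decomp assms(1) by blast
  have "geo m X dvd 1 + X ^ m" by (simp only: one_plus_power dvd_triv_right)
  also have "\<dots> dvd 1 + X ^ n"
    unfolding ml(2) one_plus_power_pow2 by (rule dvd_power) simp
  also have "1 + X ^ n = X ^ 0 * ((X + 1) ^ Suc f * 1)"
    unfolding one_plus_power assms(2) power_0 power_Suc mult_1_left mult_1_right
    by (subst add.commute) (rule refl)
  finally have "geo m X dvd 1"
    by (rule dvd_X_X1_power_mult_cancel[rotated 2])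
      (use ml(1) in \<open>simp_all add: poly_geo_X_0 poly_geo_odd odd_pos\<close>)
  then have "m = 1" using geo_X_eq_1_iff ml(1) odd_pos by (auto simp: bit_poly_unit_iff)
  then show "\<exists>q. n = 2 ^ q" using ml by auto
  have "degree ((X + 1) ^ f) = f" using degree_linear_power[of 1 f] by (simp add: one_pCons)
  then show "f = n - 1" using degree_geo_X[of n] unfolding assms(2) by (rule trans[OF sym])
qed

section \<open>Prime factors of unitary perfect polynomials\<close>

lemma X_neq_X1: "X \<noteq> X + 1"
  by (metis add_cancel_left_right one_neq_zero)

lemma dvd_unitary_perfect:
  assumes "unitary_perfect A" "A \<noteq> 0" "irreducible p" "p dvd A"
  shows "\<exists>n>0. 1 + p ^ n dvd A"
proof -
  obtain n B where nB: "A = p ^ n * B" "\<not> p dvd B"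
    using bit_poly_prime_power_split assms(2,3) by blast
  have "n > 0" using nB assms(4) by (cases n) auto
  then have "sigma_star A = (1 + p ^ n) * sigma_star B"
    using nB sigma_star_prime_power_mult bit_poly_irreducible_imp_prime assms(3) by blast
  then show ?thesis
    using assms(1) \<open>n > 0\<close> unfolding unitary_perfect_def by (metis dvd_triv_left)
qed

lemma poly_eq_0_if_dvd: "p dvd q \<Longrightarrow> poly p c = 0 \<Longrightarrow> poly q c = 0"
  by (elim dvdE) simp

text \<open>If \<open>p\<close> is an irreducible factor other than \<open>X\<close>, then \<open>1 + p ^ n\<close> vanishes at \<open>0\<close>;
  if \<open>p\<close> is \<open>X\<close>, then \<open>1 + p ^ n\<close> vanishes at \<open>1\<close>, which makes \<open>X + 1\<close> a factor as well.\<close>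

lemma X_dvd_unitary_perfect:
  assumes "unitary_perfect A" "degree A > 0"
  shows "X dvd A"
proof -
  have A: "A \<noteq> 0" using assms(2) by auto
  obtain p where p: "irreducible p" "p dvd A"
    using bit_poly_irreducible_divisor assms(2) by blast
  show ?thesis
  proof (cases "p = X")
    case False
    obtain n where "1 + p ^ n dvd A" using dvd_unitary_perfect[OF assms(1) A p] by blast
    moreover have "poly (1 + p ^ n) 0 = 0"
      using irreducible_poly_eq_1(1)[OF p(1) False] by simp
    ultimately show ?thesis unfolding X_dvd_iff by (rule poly_eq_0_if_dvd)
  qed (use p in simp)
qed

lemma X1_dvd_unitary_perfect:
  assumes "unitary_perfect A" "degree A > 0"
  shows "X + 1 dvd A"
proof -
  have A: "A \<noteq> 0" using assms(2) by auto
  obtain n where "1 + X ^ n dvd A" 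
    using dvd_unitary_perfect[OF assms(1) A prime_elem_imp_irreducible[OF prime_X] X_dvd_unitary_perfect[OF assms]] by blast
  moreover have "poly (1 + X ^ n) 1 = 0" by simp
  ultimately show ?thesis unfolding X1_dvd_iff by (rule poly_eq_0_if_dvd)
qed

lemma not_X_dvd_X1_power_mult: "poly B 0 = 1 \<Longrightarrow> \<not> X dvd (X + 1) ^ b * B"
  unfolding X_dvd_iff by simp

lemma not_X1_dvd_power: "poly p 1 = 1 \<Longrightarrow> \<not> X + 1 dvd p ^ c"
  unfolding X1_dvd_iff by simp

text \<open>Unique factorization for three primes, split off one at a time; the values at 0 and 1
  show that the remaining factors do not contain \<open>X\<close> or \<open>X + 1\<close>.\<close>

lemma exponents_eq:
  assumes "irreducible p" "p \<noteq> X" "p \<noteq> X + 1"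
    and "X ^ a * ((X + 1) ^ b * p ^ c) = X ^ a' * ((X + 1) ^ b' * p ^ c')"
  shows "a = a'" "b = b'" "c = c'"
proof -
  have val: "poly (p ^ k) 0 = 1" "poly p 1 = 1" for k
    using irreducible_poly_eq_1 assms by auto
  have 1: "a = a' \<and> (X + 1) ^ b * p ^ c = (X + 1) ^ b' * p ^ c'"
    using prime_power_mult_eqD[OF prime_X _ _ assms(4)] not_X_dvd_X1_power_mult val by blast
  then have 2: "b = b' \<and> p ^ c = p ^ c'"
    using prime_power_mult_eqD[OF prime_X1, of "p ^ c" "p ^ c'" b b'] not_X1_dvd_power val by blast
  have p: "prime_elem p" using assms(1) by (rule bit_poly_irreducible_imp_prime)
  then have "\<not> p dvd 1" by auto
  then have "c = c'"
    using 2 prime_power_mult_eqD[OF p, of 1 1 c c'] by simp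
  then show "a = a'" "b = b'" "c = c'" using 1 2 by auto
qed

lemma unitary_perfect_3_iff:
  assumes "irreducible p" "p \<noteq> X" "p \<noteq> X + 1" "a > 0" "b > 0" "c > 0"
  shows "unitary_perfect (X ^ a * ((X + 1) ^ b * p ^ c)) \<longleftrightarrow>
    (1 + X ^ a) * ((1 + (X + 1) ^ b) * (1 + p ^ c)) = X ^ a * ((X + 1) ^ b * p ^ c)"
proof -
  have val: "poly (p ^ k) 0 = 1" "poly p 1 = 1" for k
    using irreducible_poly_eq_1 assms by auto
  have p: "prime_elem p" using assms(1) by (rule bit_poly_irreducible_imp_prime)
  then have "\<not> p dvd 1" by auto
  then have "sigma_star (p ^ c) = 1 + p ^ c"
    using sigma_star_prime_power_mult[OF p _ assms(6), of 1] by simp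
  then show ?thesis
    unfolding unitary_perfect_def
      sigma_star_prime_power_mult[OF prime_X not_X_dvd_X1_power_mult[OF val(1)] assms(4)]
      sigma_star_prime_power_mult[OF prime_X1 not_X1_dvd_power[OF val(2)] assms(5)]
    by simp
qed

lemma unitary_perfect_2_iff:
  assumes "a > 0" "b > 0"
  shows "unitary_perfect (X ^ a * (X + 1) ^ b) \<longleftrightarrow>
    (1 + X ^ a) * (1 + (X + 1) ^ b) = X ^ a * (X + 1) ^ b"
proof -
  have "\<not> X + 1 dvd 1" using prime_X1 by auto
  then have "sigma_star ((X + 1) ^ b * 1) = (1 + (X + 1) ^ b) * sigma_star 1"
    using assms(2) by (rule sigma_star_prime_power_mult[OF prime_X1])
  moreover have "\<not> X dvd (X + 1) ^ b * 1"
    by (rule not_X_dvd_X1_power_mult) simp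
  then have "sigma_star (X ^ a * ((X + 1) ^ b * 1)) = (1 + X ^ a) * sigma_star ((X + 1) ^ b * 1)"
    using assms(1) by (rule sigma_star_prime_power_mult[OF prime_X])
  ultimately show ?thesis
    unfolding unitary_perfect_def mult_1_right sigma_star_1 by (simp only:)
qed

lemma unitary_perfect_cases:
  assumes "unitary_perfect A" "degree A > 0" "omega A \<le> 3"
  obtains a b where "a > 0" "b > 0" "A = X ^ a * (X + 1) ^ b"
  | a b c p where "a > 0" "b > 0" "c > 0" "irreducible p" "p \<noteq> X" "p \<noteq> X + 1"
    "A = X ^ a * ((X + 1) ^ b * p ^ c)"
proof -
  have A: "A \<noteq> 0" using assms(2) by auto
  have irr: "irreducible X" "irreducible (X + 1)"
    using prime_X prime_X1 prime_elem_imp_irreducible by blast+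
  obtain a B where B: "A = X ^ a * B" "\<not> X dvd B"
    using bit_poly_prime_power_split[OF A irr(1)] by blast
  have B0: "B \<noteq> 0" using B(2) by auto
  obtain b R where R: "B = (X + 1) ^ b * R" "\<not> X + 1 dvd R"
    using bit_poly_prime_power_split[OF B0 irr(2)] by blast
  have R0: "R \<noteq> 0" using R(2) by auto
  have nX: "\<not> X dvd R" using B(2) R(1) by auto
  have a: "a > 0" using X_dvd_unitary_perfect[OF assms(1,2)] B by (cases "a = 0") simp_all
  have A_eq: "A = X ^ a * ((X + 1) ^ b * R)" using B(1) R(1) by simp
  have b: "b > 0"
  proof (rule ccontr)
    assume "\<not> b > 0"
    then have "A = X ^ a * R" unfolding A_eq by simp
    moreover have "X + 1 dvd A" by (rule X1_dvd_unitary_perfect[OF assms(1,2)])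
    ultimately have "X + 1 dvd X \<or> X + 1 dvd R"
      using prime_X1 by (metis prime_elem_dvd_mult_iff prime_elem_dvd_power)
    then show False
      using R(2) X_neq_X1 bit_poly_irreducible_dvd_irreducible[OF irr(2,1)] by metis
  qed
  show thesis
  proof (cases "degree R = 0")
    case True
    then have "R = 1" using bit_poly_degree_0 R0 by blast
    then show thesis using that(1) a b A_eq by simp
  next
    case False
    then obtain p where p: "irreducible p" "p dvd R"
      using bit_poly_irreducible_divisor by blast
    then have pX: "p \<noteq> X" "p \<noteq> X + 1" using nX R(2) by auto
    obtain c S where S: "R = p ^ c * S" "\<not> p dvd S"
      using bit_poly_prime_power_split[OF R0 p(1)] by blast
    have c: "c > 0" using p(2) S by (cases "c = 0") simp_all
    have S0: "S \<noteq> 0" using S(2) by auto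
    \<comment> \<open>A nonconstant \<open>S\<close> would supply a fourth irreducible divisor
      \<open>r\<close> of \<open>A\<close>.\<close>
    have "degree S = 0"
    proof (rule ccontr)
      assume "degree S \<noteq> 0"
      then obtain r where r: "irreducible r" "r dvd S"
        using bit_poly_irreducible_divisor by blast
      then have rR: "r dvd R" using S(1) by simp
      have ne: "r \<noteq> X" "r \<noteq> X + 1" "r \<noteq> p" using nX R(2) S(2) r rR by auto
      have dA: "X dvd A" "X + 1 dvd A" "p dvd A" "r dvd A"
        using X_dvd_unitary_perfect[OF assms(1,2)] X1_dvd_unitary_perfect[OF assms(1,2)] p(2) rR
        unfolding A_eq by (auto intro: dvd_mult)
      have lc: "lead_coeff q = 1" if "irreducible q" for q :: "bit poly"
        using that bit_not_zero_iff by (metis leading_coeff_neq_0 not_irreducible_zero)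
      have "{X, X + 1, p, r} \<subseteq> {p. irreducible p \<and> lead_coeff p = 1 \<and> p dvd A}"
        using lc irr p(1) r(1) dA by blast
      moreover have "finite {p. irreducible p \<and> lead_coeff p = 1 \<and> p dvd A}"
        by (rule finite_subset[OF _ finite_divisors_bit_poly[OF A]]) auto
      ultimately have "card {X, X + 1, p, r} \<le> omega A"
        unfolding omega_def by (rule card_mono[rotated])
      moreover have "card {X, X + 1, p, r} = 4"
        using ne pX X_neq_X1 by (auto simp: card_insert_if)
      ultimately show False using assms(3) by simp
    qed
    then have "S = 1" using bit_poly_degree_0 S0 by blast
    then show thesis using that(2) a b c p pX A_eq S(1) by simp
  qed
qed

section \<open>Irreducibility of 1 + X + ... + X ^ (n - 1)\<close>

text \<open>The trace polynomial \<open>T\<close> of the Frobenius automorphism modulo \<open>1 + x ^ n\<close>, where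
  \<open>n = 2 ^ q + 1\<close> and hence \<open>x ^ 2 ^ (q + j)\<close> is \<open>x ^ (n - 2 ^ j)\<close>, satisfies \<open>T\<^sup>2 + T = 0\<close>.\<close>

lemma frobenius_trace_dvd:
  fixes x :: "bit poly"
  assumes "n = 2 ^ q + 1" "r \<le> q"
  defines "g \<equiv> \<lambda>j. x ^ 2 ^ j + x ^ (n - 2 ^ j)"
  shows "1 + x ^ n dvd (\<Sum>j<r. g j) ^ 2 + (\<Sum>j<r. g j) + (g 0 + g r)"
  using assms(2)
proof (induction r)
  case (Suc r)
  define T where "T = (\<Sum>j<r. g j)"
  have "2 ^ Suc r \<le> (2::nat) ^ q" using Suc.prems by (intro power_increasing) auto
  \<comment> \<open>Modulo \<open>1 + x ^ n\<close> the surplus factor \<open>x ^ n\<close> is 1, so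
    \<open>g r ^ 2\<close> is congruent to \<open>g (Suc r)\<close>.\<close>
  then have exps: "2 * (n - 2 ^ r) = (n - 2 ^ Suc r) + n" using assms(1) by simp
  have sq: "(u + v) ^ 2 = u ^ 2 + v ^ 2" for u v :: "bit poly"
    using bit_poly_power_pow2_add[of u v 1] by simp
  have "g r ^ 2 = x ^ 2 ^ Suc r + x ^ (2 * (n - 2 ^ r))"
    unfolding g_def sq by (simp flip: power_mult add: mult.commute)
  then have "g r ^ 2 + g (Suc r) = x ^ (n - 2 ^ Suc r) * (1 + x ^ n)"
    unfolding exps power_add by (simp add: g_def algebra_simps)
  then have "1 + x ^ n dvd (T ^ 2 + T + (g 0 + g r)) + (g r ^ 2 + g (Suc r))"
    using Suc by (simp add: T_def)
  also have "\<dots> = (T + g r) ^ 2 + (T + g r) + (g 0 + g (Suc r))"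
    unfolding sq by (simp add: algebra_simps)
  finally show ?case by (simp add: T_def)
qed simp

lemma coeff_X_power: "coeff (X ^ n) i = (if n = i then 1 else 0)"
  by (metis coeff_monom monom_altdef smult_1_left)

text \<open>If \<open>P = geo n X\<close> were irreducible, it would divide \<open>T\<close> or \<open>T + 1\<close> and hence be equal to it
  by degree; but \<open>X\<close> occurs in \<open>T\<close> and \<open>X ^ 3\<close> does not, while both occur in \<open>P\<close>.\<close>

lemma not_irreducible_geo_X:
  assumes "q \<ge> 3"
  shows "\<not> irreducible (geo (2 ^ q + 1) X)"
proof
  define n :: nat where "n = 2 ^ q + 1"
  define P where "P = geo n X"
  define T where "T = (\<Sum>j<q. X ^ 2 ^ j + X ^ (n - 2 ^ j))"
  assume "irreducible (geo (2 ^ q + 1) X)"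
  then have P: "prime_elem P" by (simp only: P_def n_def bit_poly_irreducible_imp_prime)
  \<comment> \<open>The boundary terms \<open>g 0\<close> and \<open>g q\<close> coincide, as
    \<open>n - 1 = 2 ^ q\<close> and \<open>n - 2 ^ q = 1\<close>.\<close>
  have "(X ^ 2 ^ 0 + X ^ (n - 2 ^ 0)) + (X ^ 2 ^ q + X ^ (n - 2 ^ q)) = 0"
    unfolding bit_poly_add_eq_0_iff by (simp add: n_def add.commute)
  then have "1 + X ^ n dvd T ^ 2 + T"
    using frobenius_trace_dvd[OF n_def order_refl, of X] unfolding T_def by simp
  then have "P dvd T ^ 2 + T"
    unfolding one_plus_power P_def by (rule dvd_mult_right)
  also have "T ^ 2 + T = T * (T + 1)" by (simp add: algebra_simps power2_eq_square)
  finally have "P dvd T + 0 \<or> P dvd T + 1" using P by (simp add: prime_elem_dvd_mult_iff)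
  then obtain e where e: "P dvd T + e" "e = 0 \<or> e = 1" by blast
  then obtain k where k: "T + e = P * k" by blast
  have pow_le: "2 * 2 ^ j \<le> (2::nat) ^ q" if "j < q" for j
    using that power_increasing[of "Suc j" q "2::nat"] by simp
  \<comment> \<open>For \<open>q >= 3\<close> and \<open>j < q\<close> the exponents
    \<open>n - 2 ^ j\<close> are at least 5, so only the terms \<open>X ^ 2 ^ j\<close> affect the
    coefficients of \<open>T\<close> at 1 and 3.\<close>
  have q8: "(8::nat) \<le> 2 ^ q" using power_increasing[OF assms, of "2::nat"] by simp
  have coeff_T: "coeff T i = (\<Sum>j<q. (if 2 ^ j = i then 1 else 0) + (if n - 2 ^ j = i then 1 else 0))" for i
    unfolding T_def by (simp only: coeff_sum coeff_add coeff_X_power)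
  have coeff_e: "i > 0 \<Longrightarrow> coeff e i = 0" for i using e(2) by auto
  have "coeff T 3 = (\<Sum>j<q. 0)"
    unfolding coeff_T
  proof (intro sum.cong refl)
    fix j assume "j \<in> {..<q}"
    then have "2 * 2 ^ j \<le> (2::nat) ^ q" using pow_le by simp
    then have "n - 2 ^ j \<noteq> 3" using q8 by (simp add: n_def)
    moreover have "(2::nat) ^ j \<noteq> 3" by (cases j) (auto, presburger)
    ultimately show "(if 2 ^ j = (3::nat) then 1 else 0) + (if n - 2 ^ j = 3 then 1 else 0) = (0::bit)"
      by simp
  qed
  then have c3: "coeff (T + e) 3 = 0" using coeff_e by simp
  have "coeff T 1 = (\<Sum>j<q. if j = 0 then 1 else 0)"
    unfolding coeff_T
  proof (intro sum.cong refl)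
    fix j assume "j \<in> {..<q}"
    then have "2 * 2 ^ j \<le> (2::nat) ^ q" using pow_le by simp
    then have "n - 2 ^ j \<noteq> 1" using q8 by (simp add: n_def)
    then show "(if 2 ^ j = (1::nat) then 1 else 0) + (if n - 2 ^ j = 1 then 1 else 0) = (if j = 0 then 1 else (0::bit))"
      by simp
  qed
  then have c1: "coeff (T + e) 1 = 1" using coeff_e assms by simp
  have "degree (T + e) \<le> 2 ^ q"
  proof (rule degree_le, intro allI impI)
    fix i :: nat assume i: "2 ^ q < i"
    have "coeff T i = (\<Sum>j<q. 0)"
      unfolding coeff_T
    proof (intro sum.cong refl)
      fix j assume "j \<in> {..<q}"
      then have "2 * 2 ^ j \<le> (2::nat) ^ q" using pow_le by simp
      moreover have "(1::nat) \<le> 2 ^ j" by simp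
      ultimately have "n - 2 ^ j \<noteq> i" "2 ^ j \<noteq> i" using i unfolding n_def by linarith+
      then show "(if 2 ^ j = i then 1 else 0) + (if n - 2 ^ j = i then 1 else 0) = (0::bit)" by simp
    qed
    then show "coeff (T + e) i = 0" using coeff_e i by simp
  qed
  moreover have "degree P = 2 ^ q" by (simp add: P_def n_def degree_geo_X)
  \<comment> \<open>The coefficient at 1 shows \<open>T + e\<close> to be nonzero; its degree is at
    most that of \<open>P\<close>, so the quotient \<open>k\<close> is constant.\<close>
  moreover have k0: "k \<noteq> 0" "P \<noteq> 0" using c1 P k by auto
  ultimately have "degree k = 0" using k by (simp add: degree_mult_eq)
  then have "T + e = P" using k k0 bit_poly_degree_0 by auto
  then show False using c3 q8 by (simp add: P_def coeff_geo_X n_def)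
qed

lemma one_plus_geo_Suc: "1 + geo (Suc n) f = f * geo n f"
  unfolding geo_def sum.lessThan_Suc_shift sum_distrib_left by simp

text \<open>Since \<open>1 + geo m X = X * geo (m - 1) X\<close>, the last factor is a power of
  \<open>X + 1\<close>, so \<open>m - 1 = 2 ^ q\<close>. Oddness of \<open>m\<close> excludes
  \<open>q = 0\<close>, irreducibility excludes \<open>q >= 3\<close>.\<close>

lemma geo_X_irreducible_cases:
  assumes "odd m" "m \<noteq> 1" "irreducible (geo m X)" "1 + geo m X = X ^ e * (X + 1) ^ f"
  shows "m = 3 \<or> m = 5" and "1 + geo m X = X * (X + 1) ^ (m - 2)"
proof -
  have m: "m - 1 > 0" "m > 0" using assms(1,2) by presburger+
  have one_plus_geo_m: "1 + geo m X = X ^ 1 * geo (m - 1) X"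
    using one_plus_geo_Suc[of "m - 1" X] m(2) by simp
  have "X ^ 1 * geo (m - 1) X = X ^ e * (X + 1) ^ f"
    using assms(4) one_plus_geo_m by (rule trans[OF sym, rotated])
  moreover have "\<not> X dvd geo (m - 1) X" using poly_geo_X_0[OF m(1)] unfolding X_dvd_iff by simp
  moreover have "\<not> X dvd (X + 1) ^ f" unfolding X_dvd_iff by simp
  ultimately have geo: "geo (m - 1) X = (X + 1) ^ f"
    using prime_power_mult_eqD[OF prime_X] by blast
  have "f = m - 2" using geo_X_eq_X1_power(2)[OF m(1) geo] by simp
  then show "1 + geo m X = X * (X + 1) ^ (m - 2)"
    unfolding one_plus_geo_m geo by (simp only: power_one_right)
  obtain q where q: "m - 1 = 2 ^ q" using geo_X_eq_X1_power(1)[OF m(1) geo] by blast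
  then have mq: "m = 2 ^ q + 1" using m(2) by linarith
  then have "q \<noteq> 0" using assms(1) by (metis even_add power_0)
  moreover have "q < 3" using not_irreducible_geo_X[of q] assms(3) mq by (cases "q < 3") auto
  ultimately have "q = 1 \<or> q = 2" by auto
  then show "m = 3 \<or> m = 5" using mq by auto
qed

section \<open>The classification\<close>

lemma irreducible_bit_polyI:
  fixes p :: "bit poly"
  assumes "degree p > 0" "\<And>d. d dvd p \<Longrightarrow> 2 * degree d \<le> degree p \<Longrightarrow> d = 1"
  shows "irreducible p"
  unfolding irreducible_def bit_poly_unit_iff
proof (intro conjI allI impI)
  show "p \<noteq> 0" "p \<noteq> 1" using assms(1) by auto
  fix a b assume ab: "p = a * b"
  then have "degree p = degree a + degree b"
    using \<open>p \<noteq> 0\<close> by (simp add: degree_mult_eq)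
  then have "2 * degree a \<le> degree p \<or> 2 * degree b \<le> degree p" by linarith
  then show "a = 1 \<or> b = 1" using assms(2) ab by (metis dvd_triv_left dvd_triv_right)
qed

text \<open>Such a divisor has no root, and \<open>X ^ 2 + X + 1\<close> is the only nonconstant
  polynomial of degree at most 2 without one.\<close>

lemma small_degree_divisor:
  fixes d :: "bit poly"
  assumes "d dvd p" "poly p 0 = 1" "poly p 1 = 1" "degree d \<le> 2"
  shows "d = 1 \<or> d = [:1, 1, 1:]"
proof -
  obtain a b c e where "d = pCons a (pCons b (pCons c e))"
    by (metis pCons_cases)
  then have d: "d = [:a, b, c:]"
    using assms(4) by (auto split: if_splits)
  have "poly d 0 \<noteq> 0" "poly d 1 \<noteq> 0"
    using poly_eq_0_if_dvd[OF assms(1)] assms(2,3) by force+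
  then have "a = 1 \<and> b = c"
    unfolding d by (cases "b = 0"; cases "c = 0"; auto)
  then show ?thesis
    unfolding d by (cases "c = 0") (simp_all add: one_pCons)
qed

lemma irreducible_degree_2: "irreducible ([:1, 1, 1:] :: bit poly)"
proof (rule irreducible_bit_polyI)
  fix d :: "bit poly" assume d: "d dvd [:1, 1, 1:]" "2 * degree d \<le> degree ([:1, 1, 1:] :: bit poly)"
  then have "d = 1 \<or> d = [:1, 1, 1:]" by (intro small_degree_divisor) auto
  then show "d = 1" using d(2) by auto
qed simp

lemma irreducible_degree_4: "irreducible ([:1, 1, 1, 1, 1:] :: bit poly)"
proof (rule irreducible_bit_polyI)
  fix d :: "bit poly" assume d: "d dvd [:1, 1, 1, 1, 1:]" "2 * degree d \<le> degree ([:1, 1, 1, 1, 1:] :: bit poly)"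
  then have *: "d = 1 \<or> d = [:1, 1, 1:]" by (intro small_degree_divisor) auto
  show "d = 1"
  proof (rule ccontr)
    assume "d \<noteq> 1"
    \<comment> \<open>Dividing the quartic by \<open>X ^ 2 + X + 1\<close> gives quotient
      \<open>X ^ 2\<close> and remainder \<open>X + 1\<close>.\<close>
    then have "d dvd d * [:0, 0, 1:] + [:1, 1:]" using d(1) * by auto
    then have "d dvd [:1, 1:]" by (simp only: dvd_add_right_iff dvd_triv_left)
    then have "degree d \<le> 1" using dvd_imp_degree_le[of d "[:1, 1:]"] by simp
    then show False using * \<open>d \<noteq> 1\<close> by auto
  qed
qed simp

section \<open>Sufficiency: the listed polynomials and their powers\<close>

text \<open>Taking the \<open>2 ^ n\<close>-th power of the equation preserves its shape, because
  this power commutes with each sum \<open>1 + f\<close>.\<close>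

lemma unitary_perfect_power_pow2:
  assumes "irreducible p" "p \<noteq> X" "p \<noteq> X + 1" "a > 0" "b > 0" "c > 0"
    and "(1 + X ^ a) * ((1 + (X + 1) ^ b) * (1 + p ^ c)) = X ^ a * ((X + 1) ^ b * p ^ c)"
  shows "unitary_perfect ((X ^ a * ((X + 1) ^ b * p ^ c)) ^ 2 ^ n)"
proof -
  let ?N = "2 ^ n :: nat"
  have pos: "a * ?N > 0" "b * ?N > 0" "c * ?N > 0" using assms(4-6) by simp_all
  have eq: "(X ^ a * ((X + 1) ^ b * p ^ c)) ^ ?N = X ^ (a * ?N) * ((X + 1) ^ (b * ?N) * p ^ (c * ?N))"
    by (simp only: power_mult power_mult_distrib)
  show ?thesis
    unfolding eq unitary_perfect_3_iff[OF assms(1-3) pos] one_plus_power_pow2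
    unfolding power_mult_distrib[symmetric] assms(7) by (simp only: power_mult power_mult_distrib)
qed

lemma geo_3_X: "geo 3 X = X ^ 2 + X + 1"
  by (simp only: geo_def numeral_3_eq_3 numeral_2_eq_2 sum.lessThan_Suc lessThan_0 sum.empty power_Suc power_0
    mult_1_right add_0_left add_ac)

lemma geo_5_X: "geo 5 X = X ^ 4 + X ^ 3 + X ^ 2 + X + 1"
  by (simp add: geo_def lessThan_nat_numeral add_ac)

lemma X_powers_pCons:
  "X ^ 2 + X + 1 = [:1, 1, 1:]" "X ^ 4 + X ^ 3 + X ^ 2 + X + 1 = [:1, 1, 1, 1, 1:]" "X + 1 = [:1, 1:]"
  by (simp_all add: one_pCons eval_nat_numeral)

abbreviation primitive_unitary_perfect :: "bit poly set" where
  "primitive_unitary_perfect \<equiv>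
     {X ^ 2 + X,
      X ^ 3 * (X + 1) ^ 2 * (X ^ 2 + X + 1),
      X ^ 5 * (X + 1) ^ 4 * (X ^ 4 + X ^ 3 + X ^ 2 + X + 1),
      X ^ 3 * (X + 1) ^ 3 * (X ^ 2 + X + 1) ^ 2}"

lemma X1_plus_1: "X + 1 + 1 = X"
  by (simp only: add.assoc bit_poly_double add_0_right)

lemma X2_X: "X ^ 2 + X = X * (X + 1)"
  by (simp only: power2_eq_square distrib_left mult_1_right)

lemma X1_power_pow2: "1 + (X + 1) ^ 2 ^ n = X ^ 2 ^ n"
  unfolding bit_poly_power_pow2_add power_one by (subst (2) add.commute) (simp only: bit_poly_add_cancel)

lemma primitive_unitary_perfect_power:
  assumes "B \<in> primitive_unitary_perfect"
  shows "unitary_perfect (B ^ 2 ^ n)"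
proof -
  have ne: "[:1, 1, 1:] \<noteq> X" "[:1, 1, 1:] \<noteq> X + 1" "[:1, 1, 1, 1, 1:] \<noteq> X" "[:1, 1, 1, 1, 1:] \<noteq> X + 1"
    by (simp_all add: one_pCons)
  \<comment> \<open>In the shape \<open>X ^ a * ((X + 1) ^ b * p ^ c)\<close> the last three need
    only one computation with coefficients each.\<close>
  from assms consider "B = X * (X + 1)"
    | "B = X ^ 3 * ((X + 1) ^ 2 * [:1, 1, 1:] ^ 1)"
    | "B = X ^ 5 * ((X + 1) ^ 4 * [:1, 1, 1, 1, 1:] ^ 1)"
    | "B = X ^ 3 * ((X + 1) ^ 3 * [:1, 1, 1:] ^ 2)"
    unfolding X_powers_pCons(1,2) unfolding X2_X mult.assoc power_one_right by blast
  then show ?thesis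
  proof cases
    case 1
    have N: "(2::nat) ^ n > 0" by simp
    have eq: "1 + X ^ 2 ^ n = (X + 1) ^ 2 ^ n"
      unfolding bit_poly_power_pow2_add power_one by (rule add.commute)
    show ?thesis
      unfolding 1 power_mult_distrib unitary_perfect_2_iff[OF N N] eq X1_power_pow2 by (rule mult.commute)
  next
    case 2
    show ?thesis unfolding 2
      by (rule unitary_perfect_power_pow2[OF irreducible_degree_2 ne(1,2)])
        (simp_all add: X_powers_pCons(3) one_pCons eval_nat_numeral)
  next
    case 3
    show ?thesis unfolding 3
      by (rule unitary_perfect_power_pow2[OF irreducible_degree_4 ne(3,4)])
        (simp_all add: X_powers_pCons(3) one_pCons eval_nat_numeral)
  next
    case 4
    show ?thesis unfolding 4
      by (rule unitary_perfect_power_pow2[OF irreducible_degree_2 ne(1,2)])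
        (simp_all add: X_powers_pCons(3) one_pCons eval_nat_numeral)
  qed
qed

section \<open>Necessity: the exponents of a unitary perfect polynomial\<close>

text \<open>Both exponents are powers of 2, so the defining equation reads
  \<open>(X + 1) ^ a * X ^ b = X ^ a * (X + 1) ^ b\<close>.\<close>

lemma unitary_perfect_2_imp:
  assumes "unitary_perfect (X ^ a * (X + 1) ^ b)" "a > 0" "b > 0"
  shows "\<exists>n. \<exists>B \<in> primitive_unitary_perfect. X ^ a * (X + 1) ^ b = B ^ 2 ^ n"
proof -
  have eq: "(1 + X ^ a) * (1 + (X + 1) ^ b) = X ^ a * (X + 1) ^ b"
    using assms unitary_perfect_2_iff by blast
  have irr: "irreducible X" using prime_X prime_elem_imp_irreducible by blast
  \<comment> \<open>\<open>one_plus_X_power_dvd\<close> is used with \<open>X\<close> as the prime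
    \<open>p\<close>, to the power 0; \<open>geo m X = X\<close> fails because the constant term of
    \<open>geo m X\<close> is 1.\<close>
  have pow2: "\<exists>l. i = 2 ^ l" if i: "i > 0" "1 + X ^ i dvd X ^ r * ((X + 1) ^ s * X ^ 0)" for i r s
  proof -
    obtain m l where ml: "odd m" "i = m * 2 ^ l" "m = 1 \<or> geo m X = X"
      using one_plus_X_power_dvd[OF i(1) irr i(2)] by blast
    have "geo m X \<noteq> X"
    proof
      assume "geo m X = X"
      then show False using poly_geo_X_0[OF odd_pos[OF ml(1)]] by simp
    qed
    then show ?thesis using ml by auto
  qed
  have "1 + X ^ a dvd X ^ a * ((X + 1) ^ b * X ^ 0)"
    unfolding power_0 mult_1_right by (rule dvdI[OF eq[symmetric]])
  then obtain k where k: "a = 2 ^ k" using pow2 assms(2) by blast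
  have "1 + (X + 1) ^ b dvd X ^ a * (X + 1) ^ b"
    unfolding eq[symmetric] by (rule dvd_triv_right)
  then have "shift (1 + (X + 1) ^ b) dvd shift (X ^ a * (X + 1) ^ b)"
    unfolding shift_dvd_iff .
  then have "1 + X ^ b dvd X ^ b * ((X + 1) ^ a * X ^ 0)"
    unfolding shift_add shift_mult shift_power shift_X shift_1 X1_plus_1 power_0 mult_1_right
    by (subst mult.commute)
  then obtain l where l: "b = 2 ^ l" using pow2 assms(3) by blast
  \<comment> \<open>The factor with exponent 0 fills the place of the third prime in
    \<open>exponents_eq\<close>.\<close>
  have "X ^ b * ((X + 1) ^ a * [:1, 1, 1:] ^ 0) = X ^ a * ((X + 1) ^ b * [:1, 1, 1:] ^ 0)"
    using eq unfolding l X1_power_pow2 unfolding k bit_poly_power_pow2_add power_one power_0 mult_1_right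
    by (simp only: add.commute mult.commute)
  then have "a = b"
    by (rule exponents_eq(2)[OF irreducible_degree_2, rotated 2]) (simp_all add: one_pCons)
  then have "X ^ a * (X + 1) ^ b = (X ^ 2 + X) ^ 2 ^ k"
    unfolding X2_X k power_mult_distrib by (simp only:)
  then show ?thesis by (intro exI[of _ k] bexI[of _ "X ^ 2 + X"] insertI1)
qed

lemma degree_shift: "degree (shift p) = degree p"
  by (simp add: shift_def degree_pcompose one_pCons)

text \<open>The odd part \<open>m\<close> of \<open>a\<close> exceeds 1, so
  \<open>p = geo m X\<close> and \<open>m\<close> is 3 or 5. If the odd part \<open>n\<close> of
  \<open>b\<close> is 1, the exponents are \<open>m\<close>, \<open>m - 1\<close>, 1 times
  \<open>2 ^ k\<close>; otherwise they are 3, 3, 2 times \<open>2 ^ k\<close>.\<close>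

lemma unitary_perfect_3_imp:
  assumes "unitary_perfect (X ^ a * ((X + 1) ^ b * p ^ c))" (is "unitary_perfect ?A")
    and pos: "a > 0" "b > 0" "c > 0"
    and p: "irreducible p" "p \<noteq> X" "p \<noteq> X + 1"
    and not_pow2: "\<nexists>k. a = 2 ^ k"
  shows "\<exists>n. \<exists>B \<in> primitive_unitary_perfect. X ^ a * ((X + 1) ^ b * p ^ c) = B ^ 2 ^ n"
proof -
  have eq: "(1 + X ^ a) * ((1 + (X + 1) ^ b) * (1 + p ^ c)) = ?A"
    using assms(1) unitary_perfect_3_iff[OF p pos] by blast
  have dvds: "1 + X ^ a dvd ?A" "1 + (X + 1) ^ b dvd ?A" "1 + p ^ c dvd ?A"
    unfolding eq[symmetric] by (rule dvd_triv_left, (intro dvd_mult dvd_triv_left dvd_triv_right)+)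
  obtain m k where mk: "odd m" "a = m * 2 ^ k" "m = 1 \<or> geo m X = p"
    using one_plus_X_power_dvd[OF pos(1) p(1) dvds(1)] by blast
  have m1: "m \<noteq> 1" using mk(2) not_pow2 by auto
  then have p_eq: "geo m X = p" using mk(3) by blast
  obtain j where j: "c = 2 ^ j"
    using one_plus_prime_power_dvd(1)[OF pos(3) p dvds(3)] by blast
  obtain e f where "1 + p = X ^ e * (X + 1) ^ f"
    using one_plus_prime_power_dvd(2)[OF pos(3) p dvds(3)] by blast
  then have m: "m = 3 \<or> m = 5" and p1: "1 + p = X * (X + 1) ^ (m - 2)"
    using geo_X_irreducible_cases[OF mk(1) m1, of e f] p(1) unfolding p_eq by blast+
  have fa: "1 + X ^ a = (X + 1) ^ 2 ^ k * p ^ 2 ^ k"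
    unfolding mk(2) one_plus_power_pow2 one_plus_power[of X m] p_eq power_mult_distrib
    by (subst (2) add.commute) (rule refl)
  have fc: "1 + p ^ c = X ^ 2 ^ j * (X + 1) ^ ((m - 2) * 2 ^ j)"
    using one_plus_power_pow2[of p 1 j]
    unfolding j mult_1_left power_one_right p1 power_mult_distrib power_mult .
  \<comment> \<open>The substitution reduces the study of \<open>b\<close> to the result for
    \<open>X\<close>, with \<open>shift p\<close> as third prime.\<close>
  have "shift (1 + (X + 1) ^ b) dvd shift ?A"
    unfolding shift_dvd_iff by (rule dvds(2))
  then have "1 + X ^ b dvd X ^ b * ((X + 1) ^ a * shift p ^ c)"
    unfolding shift_add shift_mult shift_power shift_X shift_1 X1_plus_1
    by (subst mult.left_commute)
  then obtain n l where nl: "odd n" "b = n * 2 ^ l" "n = 1 \<or> geo n X = shift p"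
    using one_plus_X_power_dvd[OF pos(2) irreducible_shift[OF p(1)]] by blast
  show ?thesis
  proof (cases "n = 1")
    case True
    then have fb: "1 + (X + 1) ^ b = X ^ 2 ^ l" using X1_power_pow2[of l] nl(2) by simp
    have "X ^ (2 ^ l + 2 ^ j) * ((X + 1) ^ (2 ^ k + (m - 2) * 2 ^ j) * p ^ 2 ^ k) = ?A"
      using eq unfolding fa fb fc power_add by (simp only: mult_ac)
    note ex = exponents_eq[OF p this]
    have "2 ^ k = (2::nat) ^ j" using ex(3) j by simp
    then have "b = (1 + (m - 2)) * 2 ^ k" using ex(2) by simp
    then have A: "?A = (X ^ m * ((X + 1) ^ (1 + (m - 2)) * geo m X)) ^ 2 ^ k"
      unfolding p_eq mk(2) ex(3)[symmetric] power_mult_distrib power_mult by (simp only: power_mult)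
    from m show ?thesis
    proof
      assume "m = 3"
      then have "?A = (X ^ 3 * (X + 1) ^ 2 * (X ^ 2 + X + 1)) ^ 2 ^ k"
        unfolding A geo_3_X[symmetric] mult.assoc by (simp only: numeral_2_eq_2 numeral_3_eq_3 add_Suc add_0 diff_Suc_Suc diff_zero One_nat_def)
      then show ?thesis by blast
    next
      assume "m = 5"
      then have "1 + (m - 2) = 4" by simp
      then have "?A = (X ^ 5 * (X + 1) ^ 4 * (X ^ 4 + X ^ 3 + X ^ 2 + X + 1)) ^ 2 ^ k"
        unfolding A geo_5_X[symmetric] mult.assoc using \<open>m = 5\<close> by (simp only:)
      then show ?thesis by blast
    qed
  next
    case False
    then have sp: "geo n X = shift p" using nl(3) by blast
    \<comment> \<open>Since \<open>shift\<close> preserves degrees, \<open>n = m\<close>, and so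
      \<open>p\<close> is invariant under \<open>shift\<close>.\<close>
    have "n - 1 = m - 1"
      using arg_cong[OF sp, of degree] unfolding degree_shift p_eq[symmetric] degree_geo_X .
    then have nm: "n = m" using odd_pos[OF nl(1)] odd_pos[OF mk(1)] by simp
    then have "shift p = p" using sp p_eq by simp
    then have "1 + p = (X + 1) * X ^ (m - 2)"
      using arg_cong[OF p1, of shift] unfolding shift_add shift_mult shift_power shift_X shift_1 X1_plus_1 by simp
    \<comment> \<open>Invariance of \<open>p\<close> makes the exponents of \<open>X\<close> and
      \<open>X + 1\<close> in \<open>1 + p\<close> agree, whence \<open>m - 2 = 1\<close>.\<close>
    then have "X ^ (m - 2) * ((X + 1) ^ 1 * p ^ 0) = X ^ 1 * ((X + 1) ^ (m - 2) * p ^ 0)"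
      unfolding p1 power_0 power_one_right mult_1_right by (simp only: mult_ac)
    then have m3: "m = 3" using exponents_eq(1)[OF p] m by fastforce
    have "shift (1 + X ^ b) = X ^ 2 ^ l * p ^ 2 ^ l"
      unfolding nl(2) one_plus_power_pow2 one_plus_power[of X n] sp \<open>shift p = p\<close> power_mult_distrib
        shift_mult shift_power shift_add shift_1 shift_X
      by (subst (2) add.commute) (simp only: bit_poly_add_cancel add.commute)
    then have fb: "1 + (X + 1) ^ b = X ^ 2 ^ l * p ^ 2 ^ l"
      unfolding shift_add shift_power shift_1 shift_X .
    have "X ^ (2 ^ l + 2 ^ j) * ((X + 1) ^ (2 ^ k + (m - 2) * 2 ^ j) * p ^ (2 ^ k + 2 ^ l)) = ?A"
      using eq unfolding fa fb fc power_add by (simp only: mult_ac)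
    note ex = exponents_eq[OF p this]
    have "2 ^ l + 2 ^ j = 3 * (2::nat) ^ k" "2 ^ k + 2 ^ j = 3 * (2::nat) ^ l" "2 ^ k + 2 ^ l = c"
      using ex mk(2) nl(2) nm m3 by simp_all
    \<comment> \<open>Subtracting the first two equations gives
      \<open>4 * 2 ^ l = 4 * 2 ^ k\<close>.\<close>
    then have "2 ^ l = (2::nat) ^ k" "c = 2 * 2 ^ k" by linarith+
    then have "?A = (X ^ 3 * ((X + 1) ^ 3 * p ^ 2)) ^ 2 ^ k"
      using mk(2) nl(2) nm m3 by (simp only: power_mult_distrib power_mult)
    then have "?A = (X ^ 3 * (X + 1) ^ 3 * (X ^ 2 + X + 1) ^ 2) ^ 2 ^ k"
      unfolding geo_3_X[symmetric] p_eq[unfolded m3] mult.assoc .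
    then show ?thesis by blast
  qed
qed

text \<open>For powers of 2 the first two factors of the equation become \<open>(X + 1) ^ a\<close>
  and \<open>X ^ b\<close>, and \<open>1 + p ^ c\<close> is a product of powers of \<open>X\<close>
  and \<open>X + 1\<close>; so \<open>p\<close> is missing on the left although
  \<open>c > 0\<close>.\<close>

lemma unitary_perfect_3_not_both_pow2:
  assumes "unitary_perfect (X ^ a * ((X + 1) ^ b * p ^ c))"
    and pos: "a > 0" "b > 0" "c > 0"
    and p: "irreducible p" "p \<noteq> X" "p \<noteq> X + 1"
  shows "\<not> ((\<exists>k. a = 2 ^ k) \<and> (\<exists>l. b = 2 ^ l))"
proof
  assume "(\<exists>k. a = 2 ^ k) \<and> (\<exists>l. b = 2 ^ l)"
  then obtain k l where k: "a = 2 ^ k" and l: "b = 2 ^ l" by blast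
  note eq = iffD1[OF unitary_perfect_3_iff[OF p pos] assms(1)]
  have dvd: "1 + p ^ c dvd X ^ a * ((X + 1) ^ b * p ^ c)"
    unfolding eq[symmetric] by (intro dvd_mult dvd_triv_right)
  obtain j where j: "c = 2 ^ j"
    using one_plus_prime_power_dvd(1)[OF pos(3) p dvd] by blast
  obtain e f where ef: "1 + p = X ^ e * (X + 1) ^ f"
    using one_plus_prime_power_dvd(2)[OF pos(3) p dvd] by blast
  have fa: "1 + X ^ a = (X + 1) ^ a"
    unfolding k bit_poly_power_pow2_add power_one by (rule add.commute)
  have fb: "1 + (X + 1) ^ b = X ^ b" unfolding l by (rule X1_power_pow2)
  have fc: "1 + p ^ c = X ^ (e * c) * (X + 1) ^ (f * c)"
    using one_plus_power_pow2[of p 1 j]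
    unfolding mult_1_left power_one_right ef j power_mult_distrib power_mult .
  have "X ^ (b + e * c) * ((X + 1) ^ (a + f * c) * p ^ 0) = X ^ a * ((X + 1) ^ b * p ^ c)"
    using eq unfolding fa fb fc power_add power_0
    by (simp only: mult_ac mult_1_left mult_1_right)
  then have "0 = c" by (rule exponents_eq(3)[OF p])
  then show False using pos(3) by simp
qed

theorem theorem3p1:
  fixes A :: "bit poly"
  assumes "degree A > 0"
    and "omega A \<le> 3"
  shows "unitary_perfect A \<longleftrightarrow>
    (\<exists>C \<in> {A, pcompose A (X + 1)}. \<exists>n :: nat. \<exists>B \<in>
        {X ^ 2 + X,
         X ^ 3 * (X + 1) ^ 2 * (X ^ 2 + X + 1),
         X ^ 5 * (X + 1) ^ 4 * (X ^ 4 + X ^ 3 + X ^ 2 + X + 1),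
         X ^ 3 * (X + 1) ^ 3 * (X ^ 2 + X + 1) ^ 2}.
      C = B ^ (2 ^ n))"
proof -
  define power_of_primitive where
    "power_of_primitive C \<longleftrightarrow> (\<exists>n. \<exists>B \<in> primitive_unitary_perfect. C = B ^ 2 ^ n)" for C
  have A: "A \<noteq> 0" using assms(1) by auto
  have "unitary_perfect A \<longleftrightarrow> power_of_primitive A \<or> power_of_primitive (shift A)"
  proof
    assume perf: "unitary_perfect A"
    from perf assms show "power_of_primitive A \<or> power_of_primitive (shift A)"
    proof (cases rule: unitary_perfect_cases)
      case (1 a b)
      have "power_of_primitive A"
        unfolding power_of_primitive_def 1(3)
        by (rule unitary_perfect_2_imp[OF perf[unfolded 1(3)] 1(1,2)])
      then show ?thesis ..
    next
      case (2 a b c p)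
      show ?thesis
      proof (cases "\<exists>k. a = 2 ^ k")
        case False
        have "power_of_primitive A"
          unfolding power_of_primitive_def 2(7)
          by (rule unitary_perfect_3_imp[OF perf[unfolded 2(7)] 2(1-6) False])
        then show ?thesis ..
      next
        \<comment> \<open>Now \<open>b\<close> is not a power of 2, and \<open>shift A\<close>, with
          \<open>a\<close> and \<open>b\<close> exchanged, falls under the previous case.\<close>
        case True
        then have b: "\<nexists>l. b = 2 ^ l"
          using unitary_perfect_3_not_both_pow2[OF perf[unfolded 2(7)] 2(1-6)] by blast
        have shift_A: "shift A = X ^ b * ((X + 1) ^ a * shift p ^ c)"
          unfolding 2(7) shift_mult shift_power shift_X shift_X1 by (rule mult.left_commute)
        have perf': "unitary_perfect (shift A)" using perf unitary_perfect_shift_iff[OF A] by blast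
        have sp: "irreducible (shift p)" "shift p \<noteq> X" "shift p \<noteq> X + 1"
          using irreducible_shift[OF 2(4)] 2(5,6) shift_eq_iff[of p X] shift_eq_iff[of p "X + 1"]
          unfolding shift_X shift_X1 by blast+
        have "power_of_primitive (shift A)"
          unfolding power_of_primitive_def shift_A
          by (rule unitary_perfect_3_imp[OF perf'[unfolded shift_A] 2(2,1,3) sp b])
        then show ?thesis ..
      qed
    qed
  next
    have "unitary_perfect C" if "power_of_primitive C" for C
      using that unfolding power_of_primitive_def
      by (elim exE bexE) (simp only: primitive_unitary_perfect_power)
    moreover assume "power_of_primitive A \<or> power_of_primitive (shift A)"
    ultimately show "unitary_perfect A" using unitary_perfect_shift_iff[OF A] by blast
  qed
  also have "\<dots> \<longleftrightarrow> (\<exists>C \<in> {A, pcompose A (X + 1)}. power_of_primitive C)"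
    unfolding shift_def by blast
  finally show ?thesis unfolding power_of_primitive_def .
qed

end
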